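(* Let $d\ge2$ be an integer, $p\in[1,\infty]$, and let $E=\{|e_a\rangle\langle e_a|\}_{a=1}^d$ and $F=\{|f_b\rangle\langle f_b|\}_{b=1}^d$ be rank-1 projective measurements acting on $\mathbb{C}^d$, where $\{|e_a\rangle\}$ and $\{|f_b\rangle\}$ are orthonormal bases. Let $\tau:=\max_{a,b}|\langle e_a|f_b\rangle|^2$. Then $$\Upsilon_p(E,F)\le 2^{\frac1p}\Big[\sqrt{\tau(1-\tau)}+2\sqrt{(1-\tau)(d-2+\tau)}+\sqrt{(d-2+\tau)(d^2-3d+3-\tau)}\Big]$$ and $$\Upsilon_p(E,F)\ge(1+2m_r+m_s)\,\widetilde h_p(\tau)+2\,\widetilde h_p(1-\tau-m_r\tau)+\widetilde h_p(d-2+\tau-m_s\tau),$$ where $\widetilde h_p(t):=2^{\frac1p}\sqrt{t(1-t)}$ for $t\in[0,1]$, $m_r:=\big\lfloor\frac{1-\tau}{\tau}\big\rfloor$ and $m_s:=\big\lfloor\frac{d-2+\tau}{\tau}\big\rfloor$.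
   Context: The Schatten $p$-norm $\|A\|_p$ is the $\ell_p$-norm of the vector of singular values of $A$ (the largest singular value for $p=\infty$). For $E=\{E_a\}$, $F=\{F_b\}$ define $\Upsilon_p(E,F):=\sum_{a,b}\|[E_a,F_b]\|_p$, where $[A,B]=AB-BA$. Convention: $2^{1/p}=1$ for $p=\infty$. (The quantity $-\log\tau$ is the right-hand side of the Maassen–Uffink entropic uncertainty relation for $E$ and $F$.) *)

theory Defs
  imports
    Complex_Main
    "HOL-Library.Extended_Real"
    "Jordan_Normal_Form.Char_Poly"
    "Jordan_Normal_Form.Schur_Decomposition"
    "Jordan_Normal_Form.VS_Connect"
begin

text \<open>The eigenvalues of \<open>A\<^sup>* A\<close>, counted with algebraic multiplicity, are nonnegative reals;
  \<open>Re\<close> only changes their type.\<close>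

definition singular_values :: "complex mat \<Rightarrow> real multiset" where
  "singular_values A = image_mset (\<lambda>z. sqrt (Re z)) (proots (char_poly (mat_adjoint A * A)))"

definition schatten_norm :: "ereal \<Rightarrow> complex mat \<Rightarrow> real" where
  "schatten_norm p A =
     (if p = \<infinity> then Max (set_mset (singular_values A))
      else (\<Sum>s\<in>#singular_values A. s powr real_of_ereal p) powr (1 / real_of_ereal p))"

definition commutator :: "complex mat \<Rightarrow> complex mat \<Rightarrow> complex mat" where
  "commutator A B = A * B - B * A"

definition Upsilon ::
  "ereal \<Rightarrow> 'a set \<Rightarrow> 'b set \<Rightarrow> ('a \<Rightarrow> complex mat) \<Rightarrow> ('b \<Rightarrow> complex mat) \<Rightarrow> real" where
  "Upsilon p I J E F = (\<Sum>a\<in>I. \<Sum>b\<in>J. schatten_norm p (commutator (E a) (F b)))"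

text \<open>The product \<open>x \<bullet>c y\<close> is conjugate-linear in its second argument, so \<open>\<langle>e|f\<rangle>\<close> is \<open>f \<bullet>c e\<close>.\<close>

definition orthonormal_basis :: "nat \<Rightarrow> (nat \<Rightarrow> complex vec) \<Rightarrow> bool" where
  "orthonormal_basis d e \<longleftrightarrow>
     (\<forall>a<d. e a \<in> carrier_vec d) \<and>
     (\<forall>a<d. \<forall>b<d. e b \<bullet>c e a = (if a = b then 1 else 0)) \<and>
     vectorspace.basis class_ring (module_vec TYPE(complex) d) (e ` {..<d})"

text \<open>The operator \<open>|v\<rangle>\<langle>v|\<close>.\<close>

definition ket_bra :: "complex vec \<Rightarrow> complex mat" where
  "ket_bra v = mat (dim_vec v) (dim_vec v) (\<lambda>(i, j). v $ i * cnj (v $ j))"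

definition two_root :: "ereal \<Rightarrow> real" where
  "two_root p = (if p = \<infinity> then 1 else 2 powr (1 / real_of_ereal p))"

definition h_tilde :: "ereal \<Rightarrow> real \<Rightarrow> real" where
  "h_tilde p t = two_root p * sqrt (t * (1 - t))"

end

theory Submission
  imports Defs "HOL-Analysis.Convex"
begin

text \<open>Put \<open>c\<^sub>a\<^sub>b = |\<langle>e\<^sub>a|f\<^sub>b\<rangle>|\<^sup>2\<close>. For \<open>A = [E\<^sub>a, F\<^sub>b]\<close> one finds \<open>A\<^sup>* A = c\<^sub>a\<^sub>b (E\<^sub>a - F\<^sub>b)\<^sup>2\<close>, which is
  \<open>c\<^sub>a\<^sub>b (1 - c\<^sub>a\<^sub>b)\<close> times a rank-two projection, so \<open>\<Upsilon>\<^sub>p = 2\<^bsup>1/p\<^esup> \<Sum> g(c\<^sub>a\<^sub>b)\<close> with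
  \<open>g(t) = \<surd>(t (1 - t))\<close>. The matrix \<open>c\<close> is doubly stochastic; removing the row and the column of a
  maximal entry \<open>\<tau>\<close> leaves two strips of total \<open>1 - \<tau>\<close> and a block of total \<open>d - 2 + \<tau>\<close>. On each
  piece, Cauchy--Schwarz bounds the sum of \<open>g\<close> from above, and by concavity it is smallest when as
  many entries as possible equal \<open>\<tau>\<close> and at most one other is nonzero.\<close>

section \<open>Trace and spectrum\<close>

definition trace :: "'a :: comm_ring_1 mat \<Rightarrow> 'a" where
  "trace A = sum_list (diag_mat A)"

lemma trace_eq_sum:
  assumes "A \<in> carrier_mat n n"
  shows "trace A = (\<Sum>i<n. A $$ (i, i))"
  using assms by (simp add: trace_def diag_mat_def sum_list_distinct_conv_sum_set atLeast0LessThan[symmetric])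

lemma trace_mult_commute:
  assumes A: "A \<in> carrier_mat n m" and B: "B \<in> carrier_mat m n"
  shows "trace (A * B) = trace (B * A)"
proof -
  have "trace (A * B) = (\<Sum>i<n. \<Sum>j<m. A $$ (i, j) * B $$ (j, i))"
    using A B by (subst trace_eq_sum[of _ n]) (auto simp: scalar_prod_def atLeast0LessThan)
  also have "\<dots> = (\<Sum>j<m. \<Sum>i<n. B $$ (j, i) * A $$ (i, j))"
    by (subst sum.swap) (simp add: mult.commute)
  also have "\<dots> = trace (B * A)"
    using A B by (subst trace_eq_sum[of _ m]) (auto simp: scalar_prod_def atLeast0LessThan)
  finally show ?thesis .
qed

lemma trace_similar:
  assumes "similar_mat A B"
  shows "trace A = trace B"
proof -
  obtain n P Q where carr: "{A, B, P, Q} \<subseteq> carrier_mat n n"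
    and QP: "Q * P = 1\<^sub>m n" and AB: "A = P * B * Q"
    using similar_matD[OF assms] by blast
  have "trace A = trace (Q * (P * B))"
    unfolding AB using carr by (intro trace_mult_commute[of _ n n]) auto
  also have "Q * (P * B) = (Q * P) * B"
    using carr by (intro assoc_mult_mat[symmetric, of _ n n _ n]) auto
  also have "\<dots> = B"
    using carr by (simp add: QP left_mult_one_mat[of B n n])
  finally show ?thesis .
qed

text \<open>Schur triangularisation puts the eigenvalues, with multiplicity, on the diagonal of a
  similar matrix, and similarity preserves the trace.\<close>

lemma char_poly_factorized_trace:
  fixes A :: "complex mat"
  assumes A: "A \<in> carrier_mat n n"
  obtains es where "char_poly A = (\<Prod>a\<leftarrow>es. [:- a, 1:])" "length es = n" "sum_list es = trace A"
proof -
  obtain as where "char_poly A = (\<Prod>a\<leftarrow>as. [:- a, 1:])"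
    using char_poly_factorized[OF A] by blast
  then obtain B where B: "B \<in> carrier_mat n n" "upper_triangular B" "similar_mat A B"
    using schur_decomposition_exists[OF A] by blast
  show ?thesis
  proof
    show "char_poly A = (\<Prod>a\<leftarrow>diag_mat B. [:- a, 1:])"
      using char_poly_similar[OF B(3)] char_poly_upper_triangular[OF B(1,2)] by simp
    show "length (diag_mat B) = n"
      using B(1) by (simp add: diag_mat_def)
    show "sum_list (diag_mat B) = trace A"
      using trace_similar[OF B(3)] by (simp add: trace_def)
  qed
qed

text \<open>Applying \<open>A\<close> twice to an eigenvector \<open>v\<close> gives both
  \<open>k * x\<close> and \<open>x * x\<close> times \<open>v\<close>; compare a nonzero
  coordinate.\<close>

lemma eigenvalue_quasi_idempotent:
  fixes A :: "'a :: field mat"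
  assumes A: "A \<in> carrier_mat n n" and AA: "A * A = k \<cdot>\<^sub>m A" and ev: "eigenvalue A x"
  shows "x = 0 \<or> x = k"
proof -
  obtain v where v: "v \<in> carrier_vec n" "v \<noteq> 0\<^sub>v n" and Av: "A *\<^sub>v v = x \<cdot>\<^sub>v v"
    using ev A unfolding eigenvalue_def eigenvector_def by auto
  have "(k * x) \<cdot>\<^sub>v v = k \<cdot>\<^sub>v (A *\<^sub>v v)"
    by (simp add: Av smult_smult_assoc)
  also have "\<dots> = (k \<cdot>\<^sub>m A) *\<^sub>v v"
    using A v by (intro eq_vecI) auto
  also have "\<dots> = A *\<^sub>v (A *\<^sub>v v)"
    using AA A v by (metis assoc_mult_mat_vec)
  also have "\<dots> = (x * x) \<cdot>\<^sub>v v"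
    using A v Av by (metis mult_mat_vec smult_smult_assoc)
  finally have eq: "(k * x) \<cdot>\<^sub>v v = (x * x) \<cdot>\<^sub>v v" .
  obtain i where i: "i < n" "v $ i \<noteq> 0"
    using v by (metis carrier_vecD eq_vecI index_zero_vec)
  have "(k * x) * v $ i = (x * x) * v $ i"
    using arg_cong[OF eq, of "\<lambda>w. w $ i"] i v by simp
  then show ?thesis
    using i by auto
qed

text \<open>For nonzero \<open>k\<close>, \<phi> agrees on 0 and \<open>k\<close> with a linear
  function, so the plain sum determines the sum of \<phi>. This turns a trace into a sum of powers
  without counting occurrences of \<open>k\<close>.\<close>

lemma sum_list_two_valued:
  fixes \<phi> :: "real \<Rightarrow> real"
  assumes "set xs \<subseteq> {0, k}" and "sum_list xs = c * k" and "\<phi> 0 = 0"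
  shows "sum_list (map \<phi> xs) = c * \<phi> k"
proof (cases "k = 0")
  case True
  then have "map \<phi> xs = map (\<lambda>_. 0) xs"
    using assms by auto
  then have "sum_list (map \<phi> xs) = sum_list (map (\<lambda>_. 0) xs)"
    by (rule arg_cong)
  then show ?thesis
    using True assms by simp
next
  case False
  have "map \<phi> xs = map (\<lambda>x. \<phi> k / k * x) xs"
    using assms False by auto
  then have "sum_list (map \<phi> xs) = sum_list (map (\<lambda>x. \<phi> k / k * x) xs)"
    by (rule arg_cong)
  also have "\<dots> = \<phi> k / k * sum_list xs"
    using sum_list_const_mult[of "\<phi> k / k" "\<lambda>x. x" xs] by simp
  also have "\<dots> = c * \<phi> k"
    using False assms by simp
  finally show ?thesis .
qed

text \<open>If \<open>A\<^sup>* A\<close> is \<open>k\<close> times an idempotent, then its only eigenvalues are \<open>0\<close> and \<open>k\<close>, and the trace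
  counts the latter.\<close>

lemma schatten_norm_two_equal_singular_values:
  fixes A :: "complex mat"
  assumes n: "n > 0" and A: "A \<in> carrier_mat n n" and k: "0 \<le> k" and p: "1 \<le> p"
    and quasi: "(mat_adjoint A * A) * (mat_adjoint A * A) = complex_of_real k \<cdot>\<^sub>m (mat_adjoint A * A)"
    and tr: "trace (mat_adjoint A * A) = 2 * complex_of_real k"
  shows "schatten_norm p A = two_root p * sqrt k"
proof -
  define B where "B = mat_adjoint A * A"
  have B: "B \<in> carrier_mat n n"
    using A by (auto simp: B_def mat_adjoint_def)
  obtain es where es: "char_poly B = (\<Prod>a\<leftarrow>es. [:- a, 1:])" "length es = n" "sum_list es = trace B"
    using char_poly_factorized_trace[OF B] by blast
  define rs where "rs = map Re es"
  have "x = 0 \<or> x = complex_of_real k" if "x \<in> set es" for x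
  proof (rule eigenvalue_quasi_idempotent[OF B])
    show "B * B = complex_of_real k \<cdot>\<^sub>m B"
      using quasi by (simp add: B_def)
    show "eigenvalue B x"
      unfolding eigenvalue_root_char_poly[OF B] es(1)
      using that by (auto simp: poly_prod_list prod_list_zero_iff)
  qed
  then have rs: "set rs \<subseteq> {0, k}"
    by (force simp: rs_def)
  have sum_Re: "sum_list (map Re xs) = Re (sum_list xs)" for xs
    by (induction xs) auto
  have sum_rs: "sum_list rs = 2 * k"
    using es(3) tr by (simp add: rs_def sum_Re B_def)
  \<comment> \<open>\<open>proots\<close> records multiplicities, so \<open>es\<close> yields the
    full multiset of singular values.\<close>
  have "proots (\<Prod>a\<leftarrow>xs. [:- a, 1:]) = mset xs" for xs :: "complex list"
  proof (induction xs)
    case (Cons x xs)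
    have "(\<Prod>a\<leftarrow>xs. [:- a, 1:]) \<noteq> 0"
      by (auto simp: prod_list_zero_iff)
    then have "proots ([:- x, 1:] * (\<Prod>a\<leftarrow>xs. [:- a, 1:])) = proots [:- x, 1:] + mset xs"
      using Cons by (subst proots_mult) auto
    then show ?case
      by (simp del: mult_pCons_left)
  qed simp
  then have "proots (char_poly B) = mset es"
    unfolding es(1) .
  then have sv: "singular_values A = image_mset sqrt (mset rs)"
    by (simp add: singular_values_def B_def[symmetric] rs_def multiset.map_comp o_def)
  show ?thesis
  proof (cases "p = \<infinity>")
    case True
    have "Max (set (map sqrt rs)) = sqrt k"
    proof (cases "k = 0")
      case True
      \<comment> \<open>\<open>n > 0\<close> ensures that \<open>Max\<close> is taken over a
        nonempty set.\<close>
      moreover have "rs \<noteq> []"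
        using n es(2) by (auto simp: rs_def)
      ultimately have "set rs = {0}"
        using rs by (metis insert_absorb2 set_empty subset_singletonD)
      then show ?thesis
        using True by simp
    next
      case False
      have "k \<in> set rs"
      proof (rule ccontr)
        assume "k \<notin> set rs"
        then have "sum_list rs \<le> 0"
          using rs by (intro sum_list_nonpos) auto
        then show False
          using sum_rs k \<open>k \<noteq> 0\<close> by simp
      qed
      then show ?thesis
        using rs k by (intro Max_eqI) auto
    qed
    then show ?thesis
      using True sv by (simp add: schatten_norm_def two_root_def)
  next
    case False
    then obtain q where q: "p = ereal q" "1 \<le> q"
      using p by (cases p) auto
    have "(\<Sum>s\<in>#singular_values A. s powr q) = sum_list (map (\<lambda>x. sqrt x powr q) rs)"
      by (simp add: sv multiset.map_comp o_def sum_mset_sum_list flip: mset_map)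
    \<comment> \<open>The factor 2 comes from the trace \<open>2 * k\<close>; the summand vanishes
      at 0 because \<open>0 powr q\<close> is 0.\<close>
    also have "\<dots> = 2 * sqrt k powr q"
      using rs sum_rs q by (intro sum_list_two_valued) auto
    finally have "schatten_norm p A = (2 * sqrt k powr q) powr (1 / q)"
      using q by (simp add: schatten_norm_def)
    also have "\<dots> = 2 powr (1 / q) * sqrt k"
      using q k by (simp add: powr_mult powr_powr)
    finally show ?thesis
      using q by (simp add: two_root_def)
  qed
qed

section \<open>Commutators of rank-one projections\<close>

text \<open>The operator \<open>\<alpha> |u\<rangle>\<langle>u| + \<beta> |u\<rangle>\<langle>v| + \<gamma> |v\<rangle>\<langle>u| + \<delta> |v\<rangle>\<langle>v|\<close>.\<close>

definition pair_op ::
  "complex vec \<Rightarrow> complex vec \<Rightarrow> complex \<Rightarrow> complex \<Rightarrow> complex \<Rightarrow> complex \<Rightarrow> complex mat" where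
  "pair_op u v \<alpha> \<beta> \<gamma> \<delta> = mat (dim_vec u) (dim_vec u) (\<lambda>(i, j).
     u $ i * (\<alpha> * cnj (u $ j) + \<beta> * cnj (v $ j)) + v $ i * (\<gamma> * cnj (u $ j) + \<delta> * cnj (v $ j)))"

context
  fixes n :: nat and u v :: "complex vec" and z :: complex
  assumes u: "u \<in> carrier_vec n" and v: "v \<in> carrier_vec n"
    and uu: "u \<bullet>c u = 1" and vv: "v \<bullet>c v = 1" and vu: "v \<bullet>c u = z"
begin

lemma inner_sums:
  "(\<Sum>i<n. u $ i * cnj (u $ i)) = 1" "(\<Sum>i<n. v $ i * cnj (v $ i)) = 1"
  "(\<Sum>i<n. v $ i * cnj (u $ i)) = z" "(\<Sum>i<n. u $ i * cnj (v $ i)) = cnj z"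
proof -
  show 1: "(\<Sum>i<n. v $ i * cnj (u $ i)) = z"
    using u v vu by (simp add: scalar_prod_def atLeast0LessThan)
  show "(\<Sum>i<n. u $ i * cnj (u $ i)) = 1" "(\<Sum>i<n. v $ i * cnj (v $ i)) = 1"
    using u v uu vv by (simp_all add: scalar_prod_def atLeast0LessThan)
  show "(\<Sum>i<n. u $ i * cnj (v $ i)) = cnj z"
    by (simp flip: 1 add: mult.commute)
qed

lemma pair_op_carrier: "pair_op u v \<alpha> \<beta> \<gamma> \<delta> \<in> carrier_mat n n"
  using u by (simp add: pair_op_def)

text \<open>The new coefficient matrix is M G M', where M and M' are the 2x2 coefficient matrices of
  the factors and G is the Gram matrix of \<open>u\<close>, \<open>v\<close>, with rows (1,
  \<open>z\<close>) and (\<open>cnj z\<close>, 1).\<close>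

lemma pair_op_mult:
  "pair_op u v \<alpha> \<beta> \<gamma> \<delta> * pair_op u v \<alpha>' \<beta>' \<gamma>' \<delta>' =
     pair_op u v ((\<alpha> + \<beta> * cnj z) * \<alpha>' + (\<alpha> * z + \<beta>) * \<gamma>') ((\<alpha> + \<beta> * cnj z) * \<beta>' + (\<alpha> * z + \<beta>) * \<delta>')
                 ((\<gamma> + \<delta> * cnj z) * \<alpha>' + (\<gamma> * z + \<delta>) * \<gamma>') ((\<gamma> + \<delta> * cnj z) * \<beta>' + (\<gamma> * z + \<delta>) * \<delta>')"
  (is "?A * ?B = ?C")
proof (rule eq_matI)
  fix i j assume "i < dim_row ?C" "j < dim_col ?C"
  then have ij: "i < n" "j < n"
    using u by (auto simp: pair_op_def)
  have "(?A * ?B) $$ (i, j) = (\<Sum>k<n.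
      (u $ i * (\<alpha> * cnj (u $ k) + \<beta> * cnj (v $ k)) + v $ i * (\<gamma> * cnj (u $ k) + \<delta> * cnj (v $ k))) *
      (u $ k * (\<alpha>' * cnj (u $ j) + \<beta>' * cnj (v $ j)) + v $ k * (\<gamma>' * cnj (u $ j) + \<delta>' * cnj (v $ j))))"
    using ij u by (simp add: pair_op_def scalar_prod_def atLeast0LessThan)
  \<comment> \<open>Regroup so that the summation index occurs only in the four inner products of
    \<open>inner_sums\<close>.\<close>
  also have "\<dots> = (\<Sum>k<n.
      (u $ i * \<alpha> + v $ i * \<gamma>) * (\<alpha>' * cnj (u $ j) + \<beta>' * cnj (v $ j)) * (u $ k * cnj (u $ k)) +
      (u $ i * \<beta> + v $ i * \<delta>) * (\<alpha>' * cnj (u $ j) + \<beta>' * cnj (v $ j)) * (u $ k * cnj (v $ k)) +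
      (u $ i * \<alpha> + v $ i * \<gamma>) * (\<gamma>' * cnj (u $ j) + \<delta>' * cnj (v $ j)) * (v $ k * cnj (u $ k)) +
      (u $ i * \<beta> + v $ i * \<delta>) * (\<gamma>' * cnj (u $ j) + \<delta>' * cnj (v $ j)) * (v $ k * cnj (v $ k)))"
    by (intro sum.cong refl) (simp add: algebra_simps)
  also have "\<dots> = ?C $$ (i, j)"
    using ij u
    by (simp add: sum.distrib inner_sums pair_op_def flip: sum_distrib_left) (simp add: algebra_simps)
  finally show "(?A * ?B) $$ (i, j) = ?C $$ (i, j)" .
qed (use u in \<open>auto simp: pair_op_def\<close>)

lemma pair_op_diff:
  "pair_op u v \<alpha> \<beta> \<gamma> \<delta> - pair_op u v \<alpha>' \<beta>' \<gamma>' \<delta>' = pair_op u v (\<alpha> - \<alpha>') (\<beta> - \<beta>') (\<gamma> - \<gamma>') (\<delta> - \<delta>')"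
  by (rule eq_matI) (auto simp: pair_op_def algebra_simps)

lemma pair_op_smult:
  "k \<cdot>\<^sub>m pair_op u v \<alpha> \<beta> \<gamma> \<delta> = pair_op u v (k * \<alpha>) (k * \<beta>) (k * \<gamma>) (k * \<delta>)"
  by (rule eq_matI) (auto simp: pair_op_def algebra_simps)

lemma mat_adjoint_pair_op:
  "mat_adjoint (pair_op u v \<alpha> \<beta> \<gamma> \<delta>) = pair_op u v (cnj \<alpha>) (cnj \<gamma>) (cnj \<beta>) (cnj \<delta>)"
  by (rule eq_matI) (auto simp: mat_adjoint_def mat_of_rows_def pair_op_def algebra_simps)

lemma trace_pair_op: "trace (pair_op u v \<alpha> \<beta> \<gamma> \<delta>) = \<alpha> + \<beta> * cnj z + \<gamma> * z + \<delta>"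
proof -
  have "trace (pair_op u v \<alpha> \<beta> \<gamma> \<delta>) =
      (\<Sum>i<n. \<alpha> * (u $ i * cnj (u $ i)) + \<beta> * (u $ i * cnj (v $ i))
            + \<gamma> * (v $ i * cnj (u $ i)) + \<delta> * (v $ i * cnj (v $ i)))"
    unfolding trace_eq_sum[OF pair_op_carrier] using u
    by (intro sum.cong) (auto simp: pair_op_def algebra_simps)
  then show ?thesis
    by (simp add: sum.distrib inner_sums flip: sum_distrib_left)
qed

text \<open>All operators involved are of the form \<open>pair_op\<close>, so the criterion for two
  equal singular values, taken with k = c (1 - c) and c = |z|^2, reduces to polynomial identities
  between coefficients.\<close>

lemma schatten_norm_commutator_ket_bra:
  assumes "n > 0" and "1 \<le> p" and z: "(cmod z)\<^sup>2 \<le> 1"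
  shows "schatten_norm p (commutator (ket_bra u) (ket_bra v)) = h_tilde p ((cmod z)\<^sup>2)"
proof -
  define c where "c = (cmod z)\<^sup>2"
  have c: "z * cnj z = complex_of_real c"
    unfolding c_def by (rule complex_norm_square[symmetric])
  define A where "A = pair_op u v 0 z (- cnj z) 0"
  have E: "ket_bra u = pair_op u v 1 0 0 0"
    by (rule eq_matI) (auto simp: ket_bra_def pair_op_def)
  have F: "ket_bra v = pair_op u v 0 0 0 1"
    using u v by (intro eq_matI) (auto simp: ket_bra_def pair_op_def)
  have comm: "commutator (ket_bra u) (ket_bra v) = A"
    by (simp add: commutator_def E F pair_op_mult pair_op_diff A_def)
  define C where "C = complex_of_real c"
  have zC: "z * cnj z = C"
    by (simp add: c C_def)
  have B: "mat_adjoint A * A = pair_op u v C (- C * z) (- C * cnj z) C"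
    by (simp add: A_def mat_adjoint_pair_op pair_op_mult mult_ac flip: zC)
  \<comment> \<open>With \<open>z\<close> and \<open>cnj z\<close> for \<open>a\<close> and
    \<open>b\<close>, the first four identities compare the coefficients of the square of
    \<open>mat_adjoint A * A\<close> with those of its multiple by c (1 - c); the fifth is the
    trace.\<close>
  have quasi:
    "(C + - C * a * b) * C + (C * a + - C * a) * (- C * b) = C * (1 - C) * C"
    "(C + - C * a * b) * (- C * a) + (C * a + - C * a) * C = C * (1 - C) * (- C * a)"
    "(- C * b + C * b) * C + (- C * b * a + C) * (- C * b) = C * (1 - C) * (- C * b)"
    "(- C * b + C * b) * (- C * a) + (- C * b * a + C) * C = C * (1 - C) * C"
    "C + - C * a * b + - C * b * a + C = 2 * (C * (1 - C))"
    if "a * b = C" for a b C :: complex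
    by (simp_all add: algebra_simps flip: that)
  have "schatten_norm p A = two_root p * sqrt (c * (1 - c))"
  proof (rule schatten_norm_two_equal_singular_values)
    show "A \<in> carrier_mat n n"
      by (simp add: A_def pair_op_carrier)
    show "0 \<le> c * (1 - c)"
      using z by (simp add: c_def)
    show "mat_adjoint A * A * (mat_adjoint A * A) =
        complex_of_real (c * (1 - c)) \<cdot>\<^sub>m (mat_adjoint A * A)"
      unfolding B pair_op_mult pair_op_smult of_real_mult of_real_diff of_real_1 C_def[symmetric]
        quasi[OF zC] by (rule refl)
    show "trace (mat_adjoint A * A) = 2 * complex_of_real (c * (1 - c))"
      unfolding B trace_pair_op of_real_mult of_real_diff of_real_1 C_def[symmetric]
        quasi[OF zC] by (rule refl)
  qed (use assms in auto)
  then show ?thesis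
    by (simp add: comm h_tilde_def c_def)
qed

end

section \<open>Parseval's identity\<close>

text \<open>Expand the squares and use the completeness relation of the \<open>f b\<close>. Applied
  to both bases, this makes the matrix of overlaps doubly stochastic.\<close>

lemma parseval:
  assumes f: "\<And>b. b < d \<Longrightarrow> f b \<in> carrier_vec d"
    and orth: "\<And>a b. a < d \<Longrightarrow> b < d \<Longrightarrow> f b \<bullet>c f a = (if a = b then 1 else 0)"
    and v: "v \<in> carrier_vec d"
  shows "(\<Sum>b<d. (cmod (f b \<bullet>c v))\<^sup>2) = Re (v \<bullet>c v)"
proof -
  define U where "U = mat d d (\<lambda>(i, b). f b $ i)"
  define V where "V = mat d d (\<lambda>(b, i). cnj (f b $ i))"
  have U: "U \<in> carrier_mat d d" and V: "V \<in> carrier_mat d d"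
    by (simp_all add: U_def V_def)
  have "V * U = 1\<^sub>m d"
  proof (rule eq_matI)
    fix a b assume "a < dim_row (1\<^sub>m d :: complex mat)" "b < dim_col (1\<^sub>m d :: complex mat)"
    then have ab: "a < d" "b < d"
      by auto
    have "(V * U) $$ (a, b) = f b \<bullet>c f a"
      using ab f[OF ab(1)] f[OF ab(2)] by (simp add: U_def V_def scalar_prod_def mult.commute)
    then show "(V * U) $$ (a, b) = (1\<^sub>m d :: complex mat) $$ (a, b)"
      using ab orth by simp
  qed (simp_all add: U_def V_def)
  \<comment> \<open>Orthonormality is \<open>V * U = 1\<close>; for square matrices the left inverse
    is also a right inverse, which is completeness.\<close>
  then have UV: "U * V = 1\<^sub>m d"
    using mat_mult_left_right_inverse[OF V U] by simp
  have complete: "(\<Sum>b<d. f b $ i * cnj (f b $ j)) = (if i = j then 1 else 0)" if "i < d" "j < d" for i j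
    using arg_cong[OF UV, of "\<lambda>M. M $$ (i, j)"] that
    by (simp add: U_def V_def scalar_prod_def atLeast0LessThan)
  have "complex_of_real (\<Sum>b<d. (cmod (f b \<bullet>c v))\<^sup>2)
      = (\<Sum>b<d. (\<Sum>i<d. f b $ i * cnj (v $ i)) * cnj (\<Sum>i<d. f b $ i * cnj (v $ i)))"
    unfolding of_real_sum complex_norm_square using v by (simp add: scalar_prod_def atLeast0LessThan)
  also have "\<dots> = (\<Sum>b<d. \<Sum>i<d. \<Sum>j<d. (f b $ i * cnj (f b $ j)) * (cnj (v $ i) * v $ j))"
    unfolding sum_product cnj_sum by (intro sum.cong refl) (simp add: mult_ac)
  also have "\<dots> = (\<Sum>i<d. \<Sum>b<d. \<Sum>j<d. (f b $ i * cnj (f b $ j)) * (cnj (v $ i) * v $ j))"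
    by (rule sum.swap)
  also have "\<dots> = (\<Sum>i<d. \<Sum>j<d. \<Sum>b<d. (f b $ i * cnj (f b $ j)) * (cnj (v $ i) * v $ j))"
    by (intro sum.cong refl sum.swap)
  also have "\<dots> = (\<Sum>i<d. \<Sum>j<d. (if i = j then 1 else 0) * (cnj (v $ i) * v $ j))"
    by (simp add: complete flip: sum_distrib_right)
  also have "\<dots> = (\<Sum>i<d. v $ i * cnj (v $ i))"
    by (simp add: if_distrib[of "\<lambda>x. x * _"] mult.commute cong: if_cong)
  also have "\<dots> = v \<bullet>c v"
    using v by (simp add: scalar_prod_def atLeast0LessThan)
  finally show ?thesis
    by (metis Re_complex_of_real)
qed

section \<open>The function \<open>\<surd>(t (1 - t))\<close>\<close>

abbreviation (input) g :: "real \<Rightarrow> real" where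
  "g t \<equiv> sqrt (t * (1 - t))"

text \<open>Cauchy-Schwarz for the vectors with entries \<open>sqrt (x i)\<close> and
  \<open>sqrt (1 - x i)\<close>.\<close>

lemma sum_g_le:
  assumes "\<And>i. i \<in> I \<Longrightarrow> 0 \<le> x i \<and> x i \<le> 1"
  shows "(\<Sum>i\<in>I. g (x i)) \<le> sqrt (sum x I * (real (card I) - sum x I))"
proof (rule real_le_rsqrt)
  have "(\<Sum>i\<in>I. g (x i))\<^sup>2 = (\<Sum>i\<in>I. sqrt (x i) * sqrt (1 - x i))\<^sup>2"
    by (simp add: real_sqrt_mult)
  also have "\<dots> \<le> (\<Sum>i\<in>I. (sqrt (x i))\<^sup>2) * (\<Sum>i\<in>I. (sqrt (1 - x i))\<^sup>2)"
    by (rule Cauchy_Schwarz_ineq_sum)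
  also have "\<dots> = sum x I * (real (card I) - sum x I)"
    using assms by (simp add: sum_subtractf)
  finally show "(\<Sum>i\<in>I. g (x i))\<^sup>2 \<le> sum x I * (real (card I) - sum x I)" .
qed

text \<open>The graph is a semicircle. After squaring, only the cross term needs an
  estimate.\<close>

lemma concave_on_g: "concave_on {0..1} g"
  unfolding concave_on_def
proof (rule convex_onI)
  fix t x y :: real
  assume t: "0 < t" "t < 1" and xy: "x \<in> {0..1}" "y \<in> {0..1}"
  let ?w = "(1 - t) * x + t * y"
  have "((1 - t) * g x + t * g y)\<^sup>2 \<le> ?w * (1 - ?w)"
  proof -
    have gx: "(g x)\<^sup>2 = x * (1 - x)" and gy: "(g y)\<^sup>2 = y * (1 - y)"
      using xy by simp_all
    \<comment> \<open>Regroup the product as \<open>sqrt (x * (1 - y)) * sqrt (y * (1 - x))\<close>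
      and apply the arithmetic-geometric mean inequality.\<close>
    have "2 * (g x * g y) \<le> x * (1 - y) + y * (1 - x)"
    proof -
      have "2 * (sqrt (x * (1 - y)) * sqrt (y * (1 - x))) \<le> (sqrt (x * (1 - y)))\<^sup>2 + (sqrt (y * (1 - x)))\<^sup>2"
        using sum_squares_bound[of "sqrt (x * (1 - y))" "sqrt (y * (1 - x))"] by simp
      then show ?thesis
        using xy by (simp add: real_sqrt_mult power_mult_distrib mult_ac)
    qed
    then have "t * (1 - t) * (2 * (g x * g y)) \<le> t * (1 - t) * (x * (1 - y) + y * (1 - x))"
      using t by (intro mult_left_mono) auto
    moreover have "((1 - t) * g x + t * g y)\<^sup>2
        = (1 - t)\<^sup>2 * (g x)\<^sup>2 + t\<^sup>2 * (g y)\<^sup>2 + t * (1 - t) * (2 * (g x * g y))"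
      unfolding power2_sum power_mult_distrib by (simp only: mult_ac)
    moreover have "(1 - t)\<^sup>2 * (x * (1 - x)) + t\<^sup>2 * (y * (1 - y)) + t * (1 - t) * (x * (1 - y) + y * (1 - x))
        = ?w * (1 - ?w)"
      by (simp add: power2_eq_square algebra_simps)
    ultimately show ?thesis
      unfolding gx gy by linarith
  qed
  then have "(1 - t) * g x + t * g y \<le> g ?w"
    by (rule real_le_rsqrt)
  then show "- g ((1 - t) *\<^sub>R x + t *\<^sub>R y) \<le> (1 - t) * (- g x) + t * (- g y)"
    by simp
qed simp

text \<open>Both \<open>x\<close> and \<open>y\<close> are convex combinations of \<open>a\<close>
  and \<open>b\<close>, with interchanged weights; add the two concavity inequalities.\<close>

lemma concave_on_spread_le:
  fixes \<phi> :: "real \<Rightarrow> real"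
  assumes conc: "concave_on S \<phi>" and S: "a \<in> S" "b \<in> S"
    and x: "a \<le> x" "x \<le> b" and y: "y = a + b - x"
  shows "\<phi> a + \<phi> b \<le> \<phi> x + \<phi> y"
proof (cases "a = b")
  case True
  then show ?thesis
    using x y by simp
next
  case False
  then have ab: "a < b"
    using x by simp
  define t where "t = (x - a) / (b - a)"
  have t: "0 \<le> t" "t \<le> 1"
    using ab x by (simp_all add: t_def field_simps)
  have tba: "t * (b - a) = x - a"
    using ab by (simp add: t_def)
  have "(1 - t) * \<phi> a + t * \<phi> b \<le> \<phi> ((1 - t) *\<^sub>R a + t *\<^sub>R b)"
    using concave_onD[OF conc t S] by simp
  moreover have "(1 - t) *\<^sub>R a + t *\<^sub>R b = x"
    using tba by (simp add: algebra_simps)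
  moreover have "t * \<phi> a + (1 - t) * \<phi> b \<le> \<phi> (t *\<^sub>R a + (1 - t) *\<^sub>R b)"
    using concave_onD[OF conc _ _ S, of "1 - t"] t by simp
  moreover have "t *\<^sub>R a + (1 - t) *\<^sub>R b = y"
    using tba y by (simp add: algebra_simps)
  ultimately show ?thesis
    by (simp add: algebra_simps)
qed

text \<open>Induction on \<open>I\<close>: adding \<open>x i\<close> to the total \<open>s\<close> with remainder \<open>r\<close> modulo \<open>\<tau>\<close> either keeps the
  quotient (use the spread \<open>0, r + x i\<close> of \<open>r, x i\<close>) or increases it by one (use the spread
  \<open>r + x i - \<tau>, \<tau>\<close>).\<close>

lemma sum_concave_ge:
  fixes \<phi> :: "real \<Rightarrow> real"
  assumes conc: "concave_on {0..\<tau>} \<phi>" and \<phi>0: "\<phi> 0 = 0" and \<tau>: "0 < \<tau>"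
    and "finite I" and "\<And>i. i \<in> I \<Longrightarrow> 0 \<le> x i \<and> x i \<le> \<tau>"
  defines "q \<equiv> \<lambda>s. of_int \<lfloor>s / \<tau>\<rfloor> :: real"
  shows "q (sum x I) * \<phi> \<tau> + \<phi> (sum x I - q (sum x I) * \<tau>) \<le> (\<Sum>i\<in>I. \<phi> (x i))"
  using assms(4,5)
proof (induction I)
  case empty
  then show ?case
    by (simp add: q_def \<phi>0)
next
  case (insert i I)
  define s where "s = sum x I"
  define r where "r = s - q s * \<tau>"
  have xi: "0 \<le> x i" "x i \<le> \<tau>"
    using insert.prems by auto
  have r: "0 \<le> r" "r < \<tau>"
  proof -
    have "q s \<le> s / \<tau>" "s / \<tau> < q s + 1"
      by (simp_all add: q_def)
    then show "0 \<le> r" "r < \<tau>"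
      using \<tau> by (simp_all add: r_def field_simps)
  qed
  have IH: "q s * \<phi> \<tau> + \<phi> r \<le> (\<Sum>i\<in>I. \<phi> (x i))"
    using insert by (simp add: s_def r_def)
  \<comment> \<open>The old quotient is an integer, so only the floor of
    \<open>(r + x i) / \<tau>\<close> decides how the quotient changes.\<close>
  have split: "(x i + s) / \<tau> = of_int \<lfloor>s / \<tau>\<rfloor> + (r + x i) / \<tau>"
    using \<tau> by (simp add: r_def q_def field_simps)
  have "q (x i + s) * \<phi> \<tau> + \<phi> (x i + s - q (x i + s) * \<tau>) \<le> q s * \<phi> \<tau> + \<phi> r + \<phi> (x i)"
  proof (cases "r + x i < \<tau>")
    case True
    have "\<lfloor>(r + x i) / \<tau>\<rfloor> = 0"
      using True r xi \<tau> by (simp add: floor_eq_iff)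
    then have q: "q (x i + s) = q s"
      unfolding q_def split by simp
    have "\<phi> 0 + \<phi> (r + x i) \<le> \<phi> r + \<phi> (x i)"
      by (rule concave_on_spread_le[OF conc]) (use True r xi in auto)
    moreover have rem: "x i + s - q s * \<tau> = r + x i"
      by (simp add: r_def)
    ultimately show ?thesis
      unfolding q rem by (simp add: \<phi>0)
  next
    case False
    \<comment> \<open>As \<open>r < \<tau>\<close> and \<open>x i \<le> \<tau>\<close>, the sum
      stays strictly below twice \<tau>, so the quotient grows by exactly one.\<close>
    have "\<lfloor>(r + x i) / \<tau>\<rfloor> = 1"
      using False r xi \<tau> by (simp add: floor_eq_iff field_simps)
    then have q: "q (x i + s) = q s + 1"
      unfolding q_def split by simp
    have "\<phi> (r + x i - \<tau>) + \<phi> \<tau> \<le> \<phi> r + \<phi> (x i)"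
      by (rule concave_on_spread_le[OF conc]) (use False r xi in auto)
    moreover have rem: "x i + s - (q s + 1) * \<tau> = r + x i - \<tau>"
      by (simp add: r_def algebra_simps)
    ultimately show ?thesis
      unfolding q rem by (simp add: algebra_simps)
  qed
  then show ?case
    using IH insert.hyps by (simp add: s_def add.commute)
qed

section \<open>Doubly stochastic matrices\<close>

theorem doubly_stochastic_sum_g_bounds:
  fixes c :: "nat \<Rightarrow> nat \<Rightarrow> real"
  assumes row: "\<And>a. a < d \<Longrightarrow> (\<Sum>b<d. c a b) = 1"
    and col: "\<And>b. b < d \<Longrightarrow> (\<Sum>a<d. c a b) = 1"
    and c: "\<And>a b. a < d \<Longrightarrow> b < d \<Longrightarrow> 0 \<le> c a b \<and> c a b \<le> \<tau>"
    and i: "i < d" and j: "j < d" and cij: "c i j = \<tau>"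
  defines "S \<equiv> (\<Sum>a<d. \<Sum>b<d. g (c a b))"
    and "m_r \<equiv> of_int \<lfloor>(1 - \<tau>) / \<tau>\<rfloor>" and "m_s \<equiv> of_int \<lfloor>(real d - 2 + \<tau>) / \<tau>\<rfloor>"
  shows "S \<le> g \<tau> + 2 * sqrt ((1 - \<tau>) * (real d - 2 + \<tau>))
             + sqrt ((real d - 2 + \<tau>) * ((real d)\<^sup>2 - 3 * real d + 3 - \<tau>))"
    and "S \<ge> (1 + 2 * m_r + m_s) * g \<tau> + 2 * g (1 - \<tau> - m_r * \<tau>) + g (real d - 2 + \<tau> - m_s * \<tau>)"
proof -
  define I where "I = {..<d} - {i}"
  define J where "J = {..<d} - {j}"
  have Id: "sum h {..<d} = h i + sum h I" for h :: "nat \<Rightarrow> real"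
    using i by (simp add: I_def sum.remove)
  have Jd: "sum h {..<d} = h j + sum h J" for h :: "nat \<Rightarrow> real"
    using j by (simp add: J_def sum.remove)
  have fin: "finite I" "finite J"
    by (simp_all add: I_def J_def)
  have card: "real (card I) = real d - 1" "real (card J) = real d - 1"
    using i j by (simp_all add: I_def J_def of_nat_diff)
  have cI: "0 \<le> c a b" "c a b \<le> \<tau>" if "a \<in> I \<or> a = i" "b \<in> J \<or> b = j" for a b
    using c[of a b] that i j by (auto simp: I_def J_def)
  have \<tau>1: "\<tau> \<le> 1"
    using member_le_sum[of j "{..<d}" "c i"] c i j row[OF i] cij by simp
  \<comment> \<open>Otherwise row \<open>i\<close> could not sum to 1. Positivity makes division
    with remainder by \<tau> meaningful.\<close>
  have \<tau>0: "0 < \<tau>"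
  proof (rule ccontr)
    assume "\<not> 0 < \<tau>"
    then have "(\<Sum>b<d. c i b) \<le> 0"
      using c i by (intro sum_nonpos) fastforce
    then show False
      using row[OF i] by simp
  qed
  have sumr: "(\<Sum>b\<in>J. c i b) = 1 - \<tau>"
    using row[OF i] by (simp add: Jd cij)
  have sumc: "(\<Sum>a\<in>I. c a j) = 1 - \<tau>"
    using col[OF j] by (simp add: Id cij)
  \<comment> \<open>The \<open>d - 1\<close> rows other than \<open>i\<close> have total
    \<open>d - 1\<close>, of which column \<open>j\<close> takes 1 - \<tau>.\<close>
  have "(\<Sum>a\<in>I. \<Sum>b\<in>J. c a b) = (\<Sum>a\<in>I. 1 - c a j)"
    using row by (intro sum.cong) (auto simp: I_def Jd eq_diff_eq add.commute)
  also have "\<dots> = real d - 2 + \<tau>"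
    by (simp add: sum_subtractf card sumc)
  finally have sums: "(\<Sum>(a, b)\<in>I \<times> J. c a b) = real d - 2 + \<tau>"
    by (simp add: sum.cartesian_product)
  have "S = (\<Sum>a<d. g (c a j) + (\<Sum>b\<in>J. g (c a b)))"
    unfolding S_def by (intro sum.cong refl Jd)
  also have "\<dots> = (\<Sum>a<d. g (c a j)) + (\<Sum>a<d. \<Sum>b\<in>J. g (c a b))"
    by (rule sum.distrib)
  also have "\<dots> = g \<tau> + (\<Sum>b\<in>J. g (c i b)) + (\<Sum>a\<in>I. g (c a j)) + (\<Sum>(a, b)\<in>I \<times> J. g (c a b))"
    unfolding Id cij by (simp add: sum.cartesian_product)
  finally have S: "S = g \<tau> + (\<Sum>b\<in>J. g (c i b)) + (\<Sum>a\<in>I. g (c a j)) + (\<Sum>(a, b)\<in>I \<times> J. g (c a b))" .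
  have conc: "concave_on {0..\<tau>} g"
    using concave_on_g \<tau>1 unfolding concave_on_def by (elim convex_on_subset) auto

  \<comment> \<open>Upper bound: each strip has \<open>d - 1\<close> cells and the block has (d -
    1)^2, which produces the quadratic in \<open>d\<close>.\<close>
  have "(\<Sum>b\<in>J. g (c i b)) \<le> sqrt ((1 - \<tau>) * (real d - 1 - (1 - \<tau>)))"
    by (rule sum_g_le[of J "c i", unfolded sumr card]) (use cI \<tau>1 in force)
  moreover have "(\<Sum>a\<in>I. g (c a j)) \<le> sqrt ((1 - \<tau>) * (real d - 1 - (1 - \<tau>)))"
    by (rule sum_g_le[of I "\<lambda>a. c a j", unfolded sumc card]) (use cI \<tau>1 in force)
  moreover have "(\<Sum>k\<in>I \<times> J. g (case k of (a, b) \<Rightarrow> c a b))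
      \<le> sqrt ((real d - 2 + \<tau>) * (real (card (I \<times> J)) - (real d - 2 + \<tau>)))"
    by (rule sum_g_le[of "I \<times> J" "\<lambda>(a, b). c a b", unfolded sums]) (use cI \<tau>1 in force)
  moreover have "real (card (I \<times> J)) - (real d - 2 + \<tau>) = (real d)\<^sup>2 - 3 * real d + 3 - \<tau>"
    by (simp add: card_cartesian_product card power2_eq_square algebra_simps)
  moreover have "real d - 1 - (1 - \<tau>) = real d - 2 + \<tau>"
    by simp
  ultimately show "S \<le> g \<tau> + 2 * sqrt ((1 - \<tau>) * (real d - 2 + \<tau>))
             + sqrt ((real d - 2 + \<tau>) * ((real d)\<^sup>2 - 3 * real d + 3 - \<tau>))"
    unfolding S by (simp add: case_prod_unfold)

  \<comment> \<open>Lower bound: the row and column strips contribute \<open>m_r\<close> copies of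
    g(\<tau>) each, the block \<open>m_s\<close>, and the corner entry one more.\<close>
  have "m_r * g \<tau> + g (1 - \<tau> - m_r * \<tau>) \<le> (\<Sum>b\<in>J. g (c i b))"
    using sum_concave_ge[OF conc _ \<tau>0 fin(2), of "c i"] cI by (simp add: sumr m_r_def)
  moreover have "m_r * g \<tau> + g (1 - \<tau> - m_r * \<tau>) \<le> (\<Sum>a\<in>I. g (c a j))"
    using sum_concave_ge[OF conc _ \<tau>0 fin(1), of "\<lambda>a. c a j"] cI by (simp add: sumc m_r_def)
  moreover have "m_s * g \<tau> + g (real d - 2 + \<tau> - m_s * \<tau>) \<le> (\<Sum>k\<in>I \<times> J. g (case k of (a, b) \<Rightarrow> c a b))"
    unfolding m_s_def sums[symmetric]
    by (rule sum_concave_ge[OF conc _ \<tau>0]) (use cI fin in auto)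
  ultimately show "S \<ge> (1 + 2 * m_r + m_s) * g \<tau> + 2 * g (1 - \<tau> - m_r * \<tau>)
      + g (real d - 2 + \<tau> - m_s * \<tau>)"
    unfolding S by (simp add: case_prod_unfold algebra_simps)
qed

section \<open>The bounds on \<open>\<Upsilon>\<^sub>p\<close>\<close>

theorem mainTheorem7:
  fixes d :: nat and p :: ereal
    and e f :: "nat \<Rightarrow> complex vec" and E F :: "nat \<Rightarrow> complex mat"
    and \<tau> :: real and m_r m_s :: int
  assumes "d \<ge> 2" and "1 \<le> p"
    and "orthonormal_basis d e" and "orthonormal_basis d f"
    and "\<And>a. a < d \<Longrightarrow> E a = ket_bra (e a)"
    and "\<And>b. b < d \<Longrightarrow> F b = ket_bra (f b)"
    and "\<tau> = Max {(cmod (f b \<bullet>c e a))\<^sup>2 | a b. a < d \<and> b < d}"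
    and "m_r = \<lfloor>(1 - \<tau>) / \<tau>\<rfloor>"
    and "m_s = \<lfloor>(real d - 2 + \<tau>) / \<tau>\<rfloor>"
  shows "Upsilon p {..<d} {..<d} E F \<le>
           two_root p * (sqrt (\<tau> * (1 - \<tau>))
             + 2 * sqrt ((1 - \<tau>) * (real d - 2 + \<tau>))
             + sqrt ((real d - 2 + \<tau>) * ((real d)\<^sup>2 - 3 * real d + 3 - \<tau>)))
         \<and> Upsilon p {..<d} {..<d} E F \<ge>
           (1 + 2 * real_of_int m_r + real_of_int m_s) * h_tilde p \<tau>
             + 2 * h_tilde p (1 - \<tau> - real_of_int m_r * \<tau>)
             + h_tilde p (real d - 2 + \<tau> - real_of_int m_s * \<tau>)"
proof -
  define c where "c = (\<lambda>a b. (cmod (f b \<bullet>c e a))\<^sup>2)"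
  have e: "e a \<in> carrier_vec d" and f: "f a \<in> carrier_vec d" if "a < d" for a
    using assms(3,4) that by (auto simp: orthonormal_basis_def)
  have eo: "e b \<bullet>c e a = (if a = b then 1 else 0)"
    and fo: "f b \<bullet>c f a = (if a = b then 1 else 0)" if "a < d" "b < d" for a b
    using assms(3,4) that by (auto simp: orthonormal_basis_def)
  have row: "(\<Sum>b<d. c a b) = 1" if "a < d" for a
    using parseval[of d f "e a", OF f fo] e eo that by (simp add: c_def)
  \<comment> \<open>Conjugate symmetry lets Parseval for the basis \<open>e\<close> give the column
    sums.\<close>
  have c_swap: "c a b = (cmod (e a \<bullet>c f b))\<^sup>2" if "a < d" "b < d" for a b
  proof -
    have "e a \<bullet>c f b = cnj (f b \<bullet>c e a)"
      using e[OF that(1)] f[OF that(2)] by (simp add: scalar_prod_def mult.commute)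
    then show ?thesis
      by (simp add: c_def)
  qed
  have col: "(\<Sum>a<d. c a b) = 1" if "b < d" for b
    using parseval[of d e "f b", OF e eo] f fo that by (simp add: c_swap)
  have c01: "0 \<le> c a b" "c a b \<le> 1" if "a < d" "b < d" for a b
    using member_le_sum[of b "{..<d}" "c a"] row that by (auto simp: c_def)

  define C where "C = {c a b | a b. a < d \<and> b < d}"
  have C: "C = (\<lambda>(a, b). c a b) ` ({..<d} \<times> {..<d})"
    by (auto simp: C_def)
  have \<tau>: "\<tau> = Max C"
    using assms(7) by (simp add: C_def c_def)
  have "finite C" "C \<noteq> {}"
    using assms(1) by (auto simp: C lessThan_empty_iff)
  then have le: "x \<le> \<tau>" if "x \<in> C" for x
    using that by (simp add: \<tau>)
  have "\<tau> \<in> C"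
    unfolding \<tau> using \<open>finite C\<close> \<open>C \<noteq> {}\<close> by (rule Max_in)
  then obtain i j where ij: "i < d" "j < d" "c i j = \<tau>"
    by (auto simp: C_def)
  have c: "0 \<le> c a b \<and> c a b \<le> \<tau>" if "a < d" "b < d" for a b
    using c01 that le[of "c a b"] by (auto simp: C_def)
  note bounds = doubly_stochastic_sum_g_bounds[of d c, OF row col c ij]

  have "schatten_norm p (commutator (E a) (F b)) = h_tilde p (c a b)" if "a < d" "b < d" for a b
    using schatten_norm_commutator_ket_bra[of "e a" d "f b" _ p] that assms e f eo fo c01(2)
    by (simp add: c_def)
  then have U: "Upsilon p {..<d} {..<d} E F = two_root p * (\<Sum>a<d. \<Sum>b<d. g (c a b))"
    by (simp add: Upsilon_def h_tilde_def sum_distrib_left)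
  have pos: "0 \<le> two_root p"
    by (simp add: two_root_def)
  \<comment> \<open>Since \<open>h_tilde p t\<close> is \<open>two_root p\<close> times g(t), both
    claims are the matrix bounds scaled by a nonnegative factor.\<close>
  show ?thesis
    using mult_left_mono[OF bounds(1) pos] mult_left_mono[OF bounds(2) pos]
    unfolding U h_tilde_def assms(8,9) by (simp add: algebra_simps)
qed

end
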